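(* Consider a predefined quantity $X=\sum_{h\in H^{long,cand}}x^{st,power\ddagger}_h$ of newly installed long-duration energy storage (LDES) power capacity. With $Y$ (feasible planning decisions with this LDES capacity), $F$ (system cost without LDES investment cost), $q^*$ (optimal value of the baseline model) and the penalty coefficient $C^{over}$ as defined in the context, consider the opportunity value maximization model $$\max_{c^{BC},\; q^{over}\ge 0,\; y\in Y}\; c^{BC}-C^{over}q^{over}\quad\text{subject to}\quad \sum_{h\in H^{long,cand}}c^{BC}x^{st,power\ddagger}_h+F(y)\le q^*+q^{over}.$$ Suppose that this model is feasible for $q^{over}=0$. Then, in the optimal solution of the model, the value $c^{BC^*}$ of $c^{BC}$ is a boundary cost, in \$/MW, below which the inclusion of investment costs related to LDES will not imply an overall system cost higher than $q^*$; that is, for a unit LDES investment cost $c$ below $c^{BC^*}$, the LDES quantity $X$ can be included, with its investment cost $cX$ counted, at an overall system cost $cX+F(y)\le q^*$ for some $y\in Y$.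
   Context: Index sets. $G$: all generators, with subsets $G^{fixed}$ (existing), $G^{cand}$ (candidates for investment), $G^{firm}$ (firm dispatchable), $G^{renew}$ (renewable), and $G^{res,providers}$ (generators that can provide reserve). $H$: all storage systems, with subsets $H^{fixed}$ (existing), $H^{cand}$ (candidates), $H^{long}$ (long duration), $H^{short}$ (short duration). Double superscripts denote intersections, e.g. $G^{firm,fixed}=G^{firm}\cap G^{fixed}$, $H^{long,cand}=H^{long}\cap H^{cand}$. $T=\{1,\dots,t^{end}\}$: time periods; $v_{h,t^{ini}}$ is the initial state of charge. Parameters. Costs: $C^{inv,gen}_g$, $C^{st,energy}_h$, $C^{st,power}_h$ (equivalent annual investment), $C^p_{gt}$ (generation), $C^{up}_{gt}$ (reserve provision), $C^I$ (power imbalance), $C^{short}$ (reserve shortage), $C^{fom,gen}_g$, $C^{fom,st,power}_h$ (fixed operation and maintenance), $C^{over}$ (penalty on the budget overrun $q^{over}$). Technical data: demand $D_t$, minimum reserve $r^{up,min}_t$, round-trip efficiency $\eta_h$, storage duration $\overline S_h$, storage limits $\underline V_h,\overline V_h,\overline V^{ini}_h,\overline P^{st,power}_h,\overline P^{st,power,ini}_h$, generator capacity $\overline P_g$, availability $f^{available}_{gt}\in[0,1]$, factors $\overline R^{up,factor}_g,RU^{factor}_g,RD^{factor}_g\in[0,1]$, investment bounds $\overline x^{inv,gen}_g,\overline x^{st,power}_h,\overline x^{st,energy}_h$, retirement bounds $\underline x^{ret,gen}_g,\overline x^{ret,gen}_g\in[0,1]$, and predefined LDES power capacities $x^{st,power\ddagger}_h$,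 $h\in H^{long,cand}$. A decision vector $y$ collects: negative/positive power imbalances $\Delta^-_t,\Delta^+_t$ and reserve shortage $\delta^{up,short}_t$; generation $p_{gt}$ and reserve $r^{up}_{gt}$ provisioned by generator $g$; storage charge $p^{st,ch}_{ht}$, discharge $p^{st,dis}_{ht}$, reserve $r^{st,up}_{ht}$, state of charge $v_{ht}$ (and $v_{h,t^{ini}}$); remaining capacity $\overline p^{rem}_g$ and retired capacity $x^{ret,gen\dagger}_g$ ($g\in G^{firm,fixed}$); invested generation capacity $x^{inv,gen\dagger}_g$ ($g\in G^{cand}$); invested storage capacities $x^{st,energy\dagger}_h,x^{st,power\dagger}_h$ ($h\in H^{cand}$). Planning constraints (for all $t\in T$ unless stated otherwise): - Balance: $\sum_{g\in G}p_{gt}=D_t+\sum_{h\in H}(p^{st,ch}_{ht}-p^{st,dis}_{ht})-\Delta^-_t+\Delta^+_t$; $\Delta^-_t,\Delta^+_t\ge0$. - Reserve: $\sum_{g\in G^{res,providers}}r^{up}_{gt}+\sum_{h\in H}r^{st,up}_{ht}\ge r^{up,min}_t-\delta^{up,short}_t$; $\delta^{up,short}_t\ge0$. - $h\in H$: $v_{h1}=v_{h,t^{ini}}+\eta_hp^{st,ch}_{h1}-p^{st,dis}_{h1}$; $v_{ht}=v_{h,t-1}+\eta_hp^{st,ch}_{ht}-p^{st,dis}_{ht}$ for $t\ge2$; $v_{h,t^{ini}}=v_{h,t^{end}}$; $v_{ht}-r^{st,up}_{ht}\ge\underline V_h$; $p^{st,ch}_{ht},p^{st,dis}_{ht},r^{st,up}_{ht}\ge0$.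 - $h\in H^{fixed}$: $\underline V_h\le v_{ht}\le\overline V_h$; $0\le p^{st,ch}_{ht}\le\overline P^{st,power}_h$; $0\le p^{st,dis}_{ht}+r^{st,up}_{ht}\le\overline P^{st,power}_h$. - $h\in H^{cand}$: $\underline V_h\le v_{ht}\le\overline V^{ini}_h+x^{st,energy\dagger}_h$; $0\le p^{st,ch}_{ht}\le\overline P^{st,power,ini}_h+x^{st,power\dagger}_h$; $0\le p^{st,dis}_{ht}+r^{st,up}_{ht}\le\overline P^{st,power,ini}_h+x^{st,power\dagger}_h$; $x^{st,energy\dagger}_h=x^{st,power\dagger}_h\overline S_h$; $0\le x^{st,power\dagger}_h\le\overline x^{st,power}_h$; $0\le x^{st,energy\dagger}_h\le\overline x^{st,energy}_h$. - $g\in G^{firm,fixed}$: $0\le p_{gt}\le\overline p^{rem}_g-r^{up}_{gt}$; $0\le r^{up}_{gt}\le\overline p^{rem}_g\overline R^{up,factor}_g$; for $t\ge2$, $p_{gt}-p_{g,t-1}\le RU^{factor}_g\overline p^{rem}_g$ and $p_{g,t-1}-p_{gt}\le RD^{factor}_g\overline p^{rem}_g$; $\overline p^{rem}_g=\overline P_g-x^{ret,gen\dagger}_g$; $\underline x^{ret,gen}_g\overline P_g\le x^{ret,gen\dagger}_g\le\overline x^{ret,gen}_g\overline P_g$. - $g\in G^{renew,fixed}$: if $g\notin G^{res,providers}$, $0\le p_{gt}\le\overline P_gf^{available}_{gt}$; if $g\in G^{res,providers}$, $0\le p_{gt}\le\overline P_gf^{available}_{gt}-r^{up}_{gt}$ and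 $0\le r^{up}_{gt}\le\overline P_gf^{available}_{gt}\overline R^{up,factor}_g$. - $g\in G^{firm,cand}$: $0\le p_{gt}\le x^{inv,gen\dagger}_g-r^{up}_{gt}$; $0\le r^{up}_{gt}\le x^{inv,gen\dagger}_g\overline R^{up,factor}_g$; for $t\ge2$, $p_{gt}-p_{g,t-1}\le RU^{factor}_gx^{inv,gen\dagger}_g$ and $p_{g,t-1}-p_{gt}\le RD^{factor}_gx^{inv,gen\dagger}_g$. - $g\in G^{renew,cand}$: if $g\notin G^{res,providers}$, $0\le p_{gt}\le x^{inv,gen\dagger}_gf^{available}_{gt}$; if $g\in G^{res,providers}$, $0\le p_{gt}\le x^{inv,gen\dagger}_gf^{available}_{gt}-r^{up}_{gt}$ and $0\le r^{up}_{gt}\le x^{inv,gen\dagger}_gf^{available}_{gt}\overline R^{up,factor}_g$. - $g\in G^{cand}$: $0\le x^{inv,gen\dagger}_g\le\overline x^{inv,gen}_g$. System cost (investment other than LDES, operation, maintenance): $$\begin{aligned}F(y)=&\sum_{g\in G^{cand}}C^{inv,gen}_gx^{inv,gen\dagger}_g+\sum_{h\in H^{short,cand}}\bigl[C^{st,energy}_hx^{st,energy\dagger}_h+C^{st,power}_hx^{st,power\dagger}_h\bigr]\\&+\sum_{t\in T}\Bigl[\sum_{g\in G}(C^p_{gt}p_{gt}+C^{up}_{gt}r^{up}_{gt})+C^I(\Delta^-_t+\Delta^+_t)+C^{short}\delta^{up,short}_t\Bigr]\\&+\sum_{g\in G^{firm,fixed}}C^{fom,gen}_g\overline p^{rem}_g+\sum_{g\in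 G^{renew,fixed}}C^{fom,gen}_g\overline P_g+\sum_{g\in G^{cand}}C^{fom,gen}_gx^{inv,gen\dagger}_g\\&+\sum_{h\in H^{fixed}}C^{fom,st,power}_h\overline P^{st,power}_h+\sum_{h\in H^{cand}}C^{fom,st,power}_h\bigl(\overline P^{st,power,ini}_h+x^{st,power\dagger}_h\bigr).\end{aligned}$$ Baseline model: $q^*$ is the minimum of $F(y)$ over all $y$ satisfying the planning constraints. The set $Y$ consists of all $y$ satisfying the planning constraints with the LDES capacities fixed at the predefined values, $x^{st,power\dagger}_h=x^{st,power\ddagger}_h$ for $h\in H^{long,cand}$. The investment and retirement bounds used in the baseline model may differ from those used in $Y$ (for instance, no investments and no retirements in the baseline, forced retirement of gas generators in $Y$). The variable $q^{over}$ is the budget overrun relative to $q^*$; it relaxes the cost constraint in case the planning constraints cannot be met within the bound $q^*$. For a unit LDES investment cost $c$, the overall system cost of $y\in Y$ is $cX+F(y)$. The boundary cost of LDES is the technology cost below which the overall system cost (investment plus operations and maintenance) does not exceed the reference value $q^*$, i.e. below which LDES becomes economically viable.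
   Formalization: If C^over·X = 1, the optimal solution is taken to be one with q^over = 0, since optima with positive overrun violate the claim; renewable generators outside the reserve providers are taken to provide zero reserve, since otherwise F may be unbounded below. *)

theory Defs
  imports Complex_Main
begin

text \<open>
  Index sets are explicit subsets of the types \<open>'g\<close> (generators) and \<open>'h\<close> (storage systems); a double
  superscript in the mathematics is written as an intersection.  Parameters and decision variables
  are total functions on these types, and only their values on the index sets matter.
\<close>

record ('g, 'h) system =
  G :: "'g set"
  G_fixed :: "'g set"
  G_cand :: "'g set"
  G_firm :: "'g set"
  G_renew :: "'g set"
  G_res :: "'g set"
  H :: "'h set"
  H_fixed :: "'h set"
  H_cand :: "'h set"
  H_long :: "'h set"
  H_short :: "'h set"
  t_end :: nat
  C_inv_gen :: "'g \<Rightarrow> real"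
  C_st_energy :: "'h \<Rightarrow> real"
  C_st_power :: "'h \<Rightarrow> real"
  C_p :: "'g \<Rightarrow> nat \<Rightarrow> real"
  C_up :: "'g \<Rightarrow> nat \<Rightarrow> real"
  C_I :: real
  C_short :: real
  C_fom_gen :: "'g \<Rightarrow> real"
  C_fom_st_power :: "'h \<Rightarrow> real"
  C_over :: real
  Demand :: "nat \<Rightarrow> real"
  r_up_min :: "nat \<Rightarrow> real"
  eta :: "'h \<Rightarrow> real"
  S_dur :: "'h \<Rightarrow> real"
  V_min :: "'h \<Rightarrow> real"
  V_max :: "'h \<Rightarrow> real"
  V_max_ini :: "'h \<Rightarrow> real"
  P_st_max :: "'h \<Rightarrow> real"
  P_st_max_ini :: "'h \<Rightarrow> real"
  P_max :: "'g \<Rightarrow> real"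
  f_avail :: "'g \<Rightarrow> nat \<Rightarrow> real"
  R_up_factor :: "'g \<Rightarrow> real"
  RU_factor :: "'g \<Rightarrow> real"
  RD_factor :: "'g \<Rightarrow> real"

text \<open>
  The investment and retirement bounds form a separate record, because the baseline model and
  the set \<open>Y\<close> may use different ones while sharing all other data.
\<close>

record ('g, 'h) bounds =
  x_inv_max :: "'g \<Rightarrow> real"
  x_st_power_max :: "'h \<Rightarrow> real"
  x_st_energy_max :: "'h \<Rightarrow> real"
  x_ret_min :: "'g \<Rightarrow> real"
  x_ret_max :: "'g \<Rightarrow> real"

record ('g, 'h) decision =
  imb_neg :: "nat \<Rightarrow> real"
  imb_pos :: "nat \<Rightarrow> real"
  short_up :: "nat \<Rightarrow> real"
  p :: "'g \<Rightarrow> nat \<Rightarrow> real"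
  r_up :: "'g \<Rightarrow> nat \<Rightarrow> real"
  p_ch :: "'h \<Rightarrow> nat \<Rightarrow> real"
  p_dis :: "'h \<Rightarrow> nat \<Rightarrow> real"
  r_st :: "'h \<Rightarrow> nat \<Rightarrow> real"
  v :: "'h \<Rightarrow> nat \<Rightarrow> real"
  v_ini :: "'h \<Rightarrow> real"
  p_rem :: "'g \<Rightarrow> real"
  x_ret :: "'g \<Rightarrow> real"
  x_inv :: "'g \<Rightarrow> real"
  x_energy :: "'h \<Rightarrow> real"
  x_power :: "'h \<Rightarrow> real"

definition periods :: "('g, 'h) system \<Rightarrow> nat set" where
  "periods S = {1..t_end S}"

definition valid_system :: "('g, 'h) system \<Rightarrow> bool" where
  "valid_system S \<longleftrightarrow>
     finite (G S) \<and> finite (H S) \<and> 1 \<le> t_end S \<and>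
     G_fixed S \<subseteq> G S \<and> G_cand S \<subseteq> G S \<and> G_firm S \<subseteq> G S \<and> G_renew S \<subseteq> G S \<and> G_res S \<subseteq> G S \<and>
     H_fixed S \<subseteq> H S \<and> H_cand S \<subseteq> H S \<and> H_long S \<subseteq> H S \<and> H_short S \<subseteq> H S \<and>
     (\<forall>g\<in>G S. (\<forall>t\<in>periods S. f_avail S g t \<in> {0..1}) \<and>
        R_up_factor S g \<in> {0..1} \<and> RU_factor S g \<in> {0..1} \<and> RD_factor S g \<in> {0..1})"

definition valid_bounds :: "('g, 'h) system \<Rightarrow> ('g, 'h) bounds \<Rightarrow> bool" where
  "valid_bounds S B \<longleftrightarrow> (\<forall>g\<in>G S. x_ret_min B g \<in> {0..1} \<and> x_ret_max B g \<in> {0..1})"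

definition balance_constr :: "('g, 'h) system \<Rightarrow> ('g, 'h) decision \<Rightarrow> bool" where
  "balance_constr S y \<longleftrightarrow> (\<forall>t\<in>periods S.
     (\<Sum>g\<in>G S. p y g t) =
       Demand S t + (\<Sum>h\<in>H S. p_ch y h t - p_dis y h t) - imb_neg y t + imb_pos y t \<and>
     0 \<le> imb_neg y t \<and> 0 \<le> imb_pos y t)"

definition reserve_constr :: "('g, 'h) system \<Rightarrow> ('g, 'h) decision \<Rightarrow> bool" where
  "reserve_constr S y \<longleftrightarrow> (\<forall>t\<in>periods S.
     (\<Sum>g\<in>G_res S. r_up y g t) + (\<Sum>h\<in>H S. r_st y h t) \<ge> r_up_min S t - short_up y t \<and>
     0 \<le> short_up y t)"

definition storage_constr :: "('g, 'h) system \<Rightarrow> ('g, 'h) decision \<Rightarrow> bool" where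
  "storage_constr S y \<longleftrightarrow> (\<forall>h\<in>H S.
     v y h 1 = v_ini y h + eta S h * p_ch y h 1 - p_dis y h 1 \<and>
     (\<forall>t\<in>periods S. 2 \<le> t \<longrightarrow> v y h t = v y h (t - 1) + eta S h * p_ch y h t - p_dis y h t) \<and>
     v_ini y h = v y h (t_end S) \<and>
     (\<forall>t\<in>periods S. V_min S h \<le> v y h t - r_st y h t \<and>
        0 \<le> p_ch y h t \<and> 0 \<le> p_dis y h t \<and> 0 \<le> r_st y h t))"

definition storage_fixed_constr :: "('g, 'h) system \<Rightarrow> ('g, 'h) decision \<Rightarrow> bool" where
  "storage_fixed_constr S y \<longleftrightarrow> (\<forall>h\<in>H_fixed S. \<forall>t\<in>periods S.
     V_min S h \<le> v y h t \<and> v y h t \<le> V_max S h \<and>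
     0 \<le> p_ch y h t \<and> p_ch y h t \<le> P_st_max S h \<and>
     0 \<le> p_dis y h t + r_st y h t \<and> p_dis y h t + r_st y h t \<le> P_st_max S h)"

definition storage_cand_constr ::
    "('g, 'h) system \<Rightarrow> ('g, 'h) bounds \<Rightarrow> ('g, 'h) decision \<Rightarrow> bool" where
  "storage_cand_constr S B y \<longleftrightarrow> (\<forall>h\<in>H_cand S.
     (\<forall>t\<in>periods S.
        V_min S h \<le> v y h t \<and> v y h t \<le> V_max_ini S h + x_energy y h \<and>
        0 \<le> p_ch y h t \<and> p_ch y h t \<le> P_st_max_ini S h + x_power y h \<and>
        0 \<le> p_dis y h t + r_st y h t \<and>
        p_dis y h t + r_st y h t \<le> P_st_max_ini S h + x_power y h) \<and>
     x_energy y h = x_power y h * S_dur S h \<and>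
     0 \<le> x_power y h \<and> x_power y h \<le> x_st_power_max B h \<and>
     0 \<le> x_energy y h \<and> x_energy y h \<le> x_st_energy_max B h)"

definition firm_fixed_constr ::
    "('g, 'h) system \<Rightarrow> ('g, 'h) bounds \<Rightarrow> ('g, 'h) decision \<Rightarrow> bool" where
  "firm_fixed_constr S B y \<longleftrightarrow> (\<forall>g\<in>G_firm S \<inter> G_fixed S.
     (\<forall>t\<in>periods S.
        0 \<le> p y g t \<and> p y g t \<le> p_rem y g - r_up y g t \<and>
        0 \<le> r_up y g t \<and> r_up y g t \<le> p_rem y g * R_up_factor S g \<and>
        (2 \<le> t \<longrightarrow>
           p y g t - p y g (t - 1) \<le> RU_factor S g * p_rem y g \<and>
           p y g (t - 1) - p y g t \<le> RD_factor S g * p_rem y g)) \<and>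
     p_rem y g = P_max S g - x_ret y g \<and>
     x_ret_min B g * P_max S g \<le> x_ret y g \<and> x_ret y g \<le> x_ret_max B g * P_max S g)"

definition renew_fixed_constr :: "('g, 'h) system \<Rightarrow> ('g, 'h) decision \<Rightarrow> bool" where
  "renew_fixed_constr S y \<longleftrightarrow> (\<forall>g\<in>G_renew S \<inter> G_fixed S. \<forall>t\<in>periods S.
     (if g \<in> G_res S then
        0 \<le> p y g t \<and> p y g t \<le> P_max S g * f_avail S g t - r_up y g t \<and>
        0 \<le> r_up y g t \<and> r_up y g t \<le> P_max S g * f_avail S g t * R_up_factor S g
      else 0 \<le> p y g t \<and> p y g t \<le> P_max S g * f_avail S g t))"

definition firm_cand_constr :: "('g, 'h) system \<Rightarrow> ('g, 'h) decision \<Rightarrow> bool" where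
  "firm_cand_constr S y \<longleftrightarrow> (\<forall>g\<in>G_firm S \<inter> G_cand S. \<forall>t\<in>periods S.
     0 \<le> p y g t \<and> p y g t \<le> x_inv y g - r_up y g t \<and>
     0 \<le> r_up y g t \<and> r_up y g t \<le> x_inv y g * R_up_factor S g \<and>
     (2 \<le> t \<longrightarrow>
        p y g t - p y g (t - 1) \<le> RU_factor S g * x_inv y g \<and>
        p y g (t - 1) - p y g t \<le> RD_factor S g * x_inv y g))"

definition renew_cand_constr :: "('g, 'h) system \<Rightarrow> ('g, 'h) decision \<Rightarrow> bool" where
  "renew_cand_constr S y \<longleftrightarrow> (\<forall>g\<in>G_renew S \<inter> G_cand S. \<forall>t\<in>periods S.
     (if g \<in> G_res S then
        0 \<le> p y g t \<and> p y g t \<le> x_inv y g * f_avail S g t - r_up y g t \<and>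
        0 \<le> r_up y g t \<and> r_up y g t \<le> x_inv y g * f_avail S g t * R_up_factor S g
      else 0 \<le> p y g t \<and> p y g t \<le> x_inv y g * f_avail S g t))"

definition gen_cand_constr ::
    "('g, 'h) system \<Rightarrow> ('g, 'h) bounds \<Rightarrow> ('g, 'h) decision \<Rightarrow> bool" where
  "gen_cand_constr S B y \<longleftrightarrow> (\<forall>g\<in>G_cand S. 0 \<le> x_inv y g \<and> x_inv y g \<le> x_inv_max B g)"

text \<open>
  A renewable generator outside \<open>G_res\<close> provides no reserve: no planning constraint mentions its
  reserve, which nevertheless occurs in the cost, where the sum ranges over all generators.
  Without this convention the cost could be unbounded below.
\<close>

definition no_reserve_conv :: "('g, 'h) system \<Rightarrow> ('g, 'h) decision \<Rightarrow> bool" where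
  "no_reserve_conv S y \<longleftrightarrow> (\<forall>g\<in>G_renew S - G_res S. \<forall>t\<in>periods S. r_up y g t = 0)"

definition planning :: "('g, 'h) system \<Rightarrow> ('g, 'h) bounds \<Rightarrow> ('g, 'h) decision \<Rightarrow> bool" where
  "planning S B y \<longleftrightarrow>
     balance_constr S y \<and> reserve_constr S y \<and>
     storage_constr S y \<and> storage_fixed_constr S y \<and> storage_cand_constr S B y \<and>
     firm_fixed_constr S B y \<and> renew_fixed_constr S y \<and>
     firm_cand_constr S y \<and> renew_cand_constr S y \<and> gen_cand_constr S B y \<and>
     no_reserve_conv S y"

definition system_cost :: "('g, 'h) system \<Rightarrow> ('g, 'h) decision \<Rightarrow> real" where
  "system_cost S y =
     (\<Sum>g\<in>G_cand S. C_inv_gen S g * x_inv y g) +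
     (\<Sum>h\<in>H_short S \<inter> H_cand S. C_st_energy S h * x_energy y h + C_st_power S h * x_power y h) +
     (\<Sum>t\<in>periods S.
        (\<Sum>g\<in>G S. C_p S g t * p y g t + C_up S g t * r_up y g t) +
        C_I S * (imb_neg y t + imb_pos y t) + C_short S * short_up y t) +
     (\<Sum>g\<in>G_firm S \<inter> G_fixed S. C_fom_gen S g * p_rem y g) +
     (\<Sum>g\<in>G_renew S \<inter> G_fixed S. C_fom_gen S g * P_max S g) +
     (\<Sum>g\<in>G_cand S. C_fom_gen S g * x_inv y g) +
     (\<Sum>h\<in>H_fixed S. C_fom_st_power S h * P_st_max S h) +
     (\<Sum>h\<in>H_cand S. C_fom_st_power S h * (P_st_max_ini S h + x_power y h))"

definition baseline_value :: "('g, 'h) system \<Rightarrow> ('g, 'h) bounds \<Rightarrow> real \<Rightarrow> bool" where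
  "baseline_value S B q \<longleftrightarrow> (\<exists>y. is_arg_min (system_cost S) (planning S B) y \<and> q = system_cost S y)"

text \<open>In the following, \<open>xd\<close> gives the predefined LDES power capacities.\<close>

definition ldes_quantity :: "('g, 'h) system \<Rightarrow> ('h \<Rightarrow> real) \<Rightarrow> real" where
  "ldes_quantity S xd = (\<Sum>h\<in>H_long S \<inter> H_cand S. xd h)"

definition Y :: "('g, 'h) system \<Rightarrow> ('g, 'h) bounds \<Rightarrow> ('h \<Rightarrow> real) \<Rightarrow> ('g, 'h) decision set" where
  "Y S B xd = {y. planning S B y \<and> (\<forall>h\<in>H_long S \<inter> H_cand S. x_power y h = xd h)}"

text \<open>
  The opportunity value maximization model: points are triples of \<open>c\<close> (the variable boundary
  cost, of free sign), the budget overrun and a planning decision; \<open>q\<close> is the baseline value.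

  Pitfall: if \<open>C_over S * ldes_quantity S xd = 1\<close>, raising the overrun by \<open>s\<close> and \<open>c\<close> by \<open>s\<close> divided
  by the LDES quantity leaves the objective unchanged, so that there are optimal points whose \<open>c\<close> is
  inflated by a positive overrun.  In this one case an optimal point without overrun has to be selected.
\<close>

fun ov_feasible ::
    "('g, 'h) system \<Rightarrow> ('g, 'h) bounds \<Rightarrow> ('h \<Rightarrow> real) \<Rightarrow> real \<Rightarrow>
     real \<times> real \<times> ('g, 'h) decision \<Rightarrow> bool" where
  "ov_feasible S B xd q (c, q_over, y) \<longleftrightarrow>
     0 \<le> q_over \<and> y \<in> Y S B xd \<and>
     (\<Sum>h\<in>H_long S \<inter> H_cand S. c * xd h) + system_cost S y \<le> q + q_over"

fun ov_objective :: "('g, 'h) system \<Rightarrow> real \<times> real \<times> ('g, 'h) decision \<Rightarrow> real" where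
  "ov_objective S (c, q_over, y) = c - C_over S * q_over"

definition ov_optimal ::
    "('g, 'h) system \<Rightarrow> ('g, 'h) bounds \<Rightarrow> ('h \<Rightarrow> real) \<Rightarrow> real \<Rightarrow>
     real \<times> real \<times> ('g, 'h) decision \<Rightarrow> bool" where
  "ov_optimal S B xd q z \<longleftrightarrow> is_arg_max (ov_objective S) (ov_feasible S B xd q) z"

definition overall_cost ::
    "('g, 'h) system \<Rightarrow> ('h \<Rightarrow> real) \<Rightarrow> real \<Rightarrow> ('g, 'h) decision \<Rightarrow> real" where
  "overall_cost S xd c y = c * ldes_quantity S xd + system_cost S y"

text \<open>
  A boundary cost separates the unit LDES investment costs at which the reference value \<open>q\<close> can be
  kept from those at which it cannot.
\<close>

definition boundary_cost ::
    "('g, 'h) system \<Rightarrow> ('g, 'h) bounds \<Rightarrow> ('h \<Rightarrow> real) \<Rightarrow> real \<Rightarrow> real \<Rightarrow> bool" where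
  "boundary_cost S B xd q c_BC \<longleftrightarrow>
     (\<forall>c<c_BC. \<exists>y\<in>Y S B xd. overall_cost S xd c y \<le> q) \<and>
     (\<forall>c>c_BC. \<not> (\<exists>y\<in>Y S B xd. overall_cost S xd c y \<le> q))"

end

theory Submission
  imports Defs
begin

text \<open>
  Write \<open>X\<close> for the LDES quantity; it is nonnegative because \<open>Y\<close> is nonempty.  An optimal point can be
  moved along the direction that changes the overrun by \<open>s\<close> and \<open>c\<close> by \<open>s / X\<close>, which keeps the budget
  constraint.  For \<open>X = 0\<close> the variable \<open>c\<close> would be unbounded; for \<open>X > 0\<close>, moving up gives
  \<open>C_over * X \<ge> 1\<close>, and moving down to zero overrun then shows that the overrun vanishes unless
  \<open>C_over * X = 1\<close>.  Without overrun, maximality of \<open>c\<close> is the boundary property.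
\<close>

lemma ov_feasible_iff:
  "ov_feasible S B xd q (c, s, y) \<longleftrightarrow> 0 \<le> s \<and> y \<in> Y S B xd \<and> overall_cost S xd c y \<le> q + s"
  by (simp add: overall_cost_def ldes_quantity_def sum_distrib_left)

text \<open>The sign of \<open>xd\<close> comes from the planning constraint on
  \<open>x_power\<close>, which \<open>Y\<close> pins to \<open>xd\<close>.\<close>

lemma ldes_quantity_nonneg:
  assumes "y \<in> Y S B xd"
  shows "0 \<le> ldes_quantity S xd"
  unfolding ldes_quantity_def
proof (rule sum_nonneg)
  fix h assume h: "h \<in> H_long S \<inter> H_cand S"
  with assms have "x_power y h = xd h" by (simp add: Y_def)
  moreover from assms h have "0 \<le> x_power y h"
    by (auto simp: Y_def planning_def storage_cand_constr_def)
  ultimately show "0 \<le> xd h" by simp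
qed

lemma ov_optimalD:
  assumes "ov_optimal S B xd q (c, s, y)"
  shows "0 \<le> s" "y \<in> Y S B xd" "overall_cost S xd c y \<le> q + s"
    and "\<And>c' s' y'. \<lbrakk>0 \<le> s'; y' \<in> Y S B xd; overall_cost S xd c' y' \<le> q + s'\<rbrakk>
      \<Longrightarrow> c' - C_over S * s' \<le> c - C_over S * s"
proof -
  have *: "ov_feasible S B xd q (c, s, y)"
    "\<And>z. ov_feasible S B xd q z \<Longrightarrow> ov_objective S z \<le> ov_objective S (c, s, y)"
    using assms unfolding ov_optimal_def is_arg_max_def by (blast, meson not_less)
  from *(1) show "0 \<le> s" "y \<in> Y S B xd" "overall_cost S xd c y \<le> q + s"
    by (simp_all only: ov_feasible_iff)
  show "c' - C_over S * s' \<le> c - C_over S * s"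
    if "0 \<le> s'" "y' \<in> Y S B xd" "overall_cost S xd c' y' \<le> q + s'" for c' s' y'
    using *(2)[of "(c', s', y')"] that
    by (simp add: ov_feasible_iff del: ov_feasible.simps)
qed

lemma ov_optimal_quantity_pos:
  assumes "ov_optimal S B xd q (c, s, y)"
  shows "0 < ldes_quantity S xd"
proof (rule ccontr)
  assume "\<not> ?thesis"
  with ldes_quantity_nonneg[OF ov_optimalD(2)[OF assms]] have "ldes_quantity S xd = 0" by simp
  \<comment> \<open>The budget no longer sees \<open>c\<close>, so raising it is free and improves
    the objective.\<close>
  then have "overall_cost S xd (c + 1) y = overall_cost S xd c y" by (simp add: overall_cost_def)
  with ov_optimalD(1-3)[OF assms] ov_optimalD(4)[OF assms, of s y "c + 1"] show False by simp
qed

lemma overall_cost_shift: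
  assumes "ldes_quantity S xd \<noteq> 0"
  shows "overall_cost S xd (c + s / ldes_quantity S xd) y = overall_cost S xd c y + s"
  using assms by (simp add: overall_cost_def field_simps)

lemma ov_optimal_no_overrun:
  assumes opt: "ov_optimal S B xd q (c, s, y)"
    and ne: "C_over S * ldes_quantity S xd \<noteq> 1"
  shows "s = 0"
proof -
  let ?X = "ldes_quantity S xd"
  note D = ov_optimalD[OF opt]
  have X: "0 < ?X" using ov_optimal_quantity_pos[OF opt] .
  \<comment> \<open>Here \<open>t\<close> is signed: both directions are covered as long as the new
    overrun \<open>s + t\<close> stays nonnegative.\<close>
  have move: "t / ?X \<le> C_over S * t" if "0 \<le> s + t" for t
    using D(4)[OF that D(2), of "c + t / ?X"] D(3) X
    by (simp add: overall_cost_shift algebra_simps)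
  have "1 / ?X \<le> C_over S" using move[of 1] D(1) by simp
  moreover have "1 / ?X \<noteq> C_over S" using ne X by (auto simp: field_simps)
  ultimately have "1 / ?X < C_over S" by simp
  \<comment> \<open>The choice \<open>t = - s\<close> removes the whole overrun; a positive
    \<open>s\<close> would contradict the strict bound on \<open>C_over S\<close>.\<close>
  moreover have "C_over S * s \<le> (1 / ?X) * s" using move[of "- s"] by simp
  ultimately have "\<not> 0 < s" using mult_strict_right_mono[of "1 / ?X" "C_over S" s] by linarith
  with D(1) show ?thesis by simp
qed

lemma ov_optimal_boundary_cost:
  assumes opt: "ov_optimal S B xd q (c, 0, y)"
  shows "boundary_cost S B xd q c"
  unfolding boundary_cost_def
proof (intro conjI allI impI)
  note D = ov_optimalD[OF opt]
  fix c' :: real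
  {
    assume "c' < c"
    \<comment> \<open>The optimal decision itself serves every smaller cost.\<close>
    then have "overall_cost S xd c' y \<le> overall_cost S xd c y"
      using ldes_quantity_nonneg[OF D(2)] by (simp add: overall_cost_def mult_right_mono)
    with D(2,3) show "\<exists>y\<in>Y S B xd. overall_cost S xd c' y \<le> q" by force
  next
    assume "c < c'"
    \<comment> \<open>A decision within \<open>q\<close> at cost \<open>c'\<close> would be feasible
      without overrun and have objective \<open>c' > c\<close>.\<close>
    with D(4)[of 0 _ c'] show "\<not> (\<exists>y\<in>Y S B xd. overall_cost S xd c' y \<le> q)" by force
  }
qed

theorem mainTheorem1:
  fixes S :: "('g, 'h) system"
    and B_base B :: "('g, 'h) bounds"
    and xd :: "'h \<Rightarrow> real"
    and q_star c_BC q_over :: real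
    and y_opt :: "('g, 'h) decision"
  assumes "valid_system S"
    and "valid_bounds S B_base"
    and "valid_bounds S B"
    and baseline: "baseline_value S B_base q_star"
    and feasible: "\<exists>c y. ov_feasible S B xd q_star (c, 0, y)"
    and optimal: "ov_optimal S B xd q_star (c_BC, q_over, y_opt)"
    and tie: "C_over S * ldes_quantity S xd = 1 \<Longrightarrow> q_over = 0"
  shows "boundary_cost S B xd q_star c_BC \<and>
    (\<forall>c<c_BC. \<exists>y\<in>Y S B xd. c * ldes_quantity S xd + system_cost S y \<le> q_star)"
proof -
  have "q_over = 0" using ov_optimal_no_overrun[OF optimal] tie by blast
  with optimal have "boundary_cost S B xd q_star c_BC" by (simp add: ov_optimal_boundary_cost)
  then show ?thesis by (simp add: boundary_cost_def overall_cost_def)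
qed

end
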